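(* Let $G$ be a finite group. If $H$ is a normal subgroup of $G$ and $g\in G'$, then $$\left|\Pr\nolimits_g(H,G)-\frac{1}{|G'|}\right|\le|G:H|\left(\Pr(G)-\frac{1}{|G'|}\right).$$
   Context: $G'$ is the commutator subgroup; $[x,y]=xyx^{-1}y^{-1}$; $\Pr_g(H,G)=|\{(x,y)\in H\times G:[x,y]=g\}|/(|H||G|)$ and $\Pr(G)=|\{(x,y)\in G\times G:xy=yx\}|/|G|^2$. *)

theory Defs
  imports Complex_Main "HOL-Algebra.Generated_Groups"
begin

definition group_commutator :: "('a, 'b) monoid_scheme \<Rightarrow> 'a \<Rightarrow> 'a \<Rightarrow> 'a" where
  "group_commutator G x y = x \<otimes>\<^bsub>G\<^esub> y \<otimes>\<^bsub>G\<^esub> inv\<^bsub>G\<^esub> x \<otimes>\<^bsub>G\<^esub> inv\<^bsub>G\<^esub> y"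

definition commutator_subgroup :: "('a, 'b) monoid_scheme \<Rightarrow> 'a set" where
  "commutator_subgroup G = derived G (carrier G)"

definition subgroup_index :: "('a, 'b) monoid_scheme \<Rightarrow> 'a set \<Rightarrow> nat" where
  "subgroup_index G H = card (rcosets\<^bsub>G\<^esub> H)"

definition commutator_prob :: "('a, 'b) monoid_scheme \<Rightarrow> 'a set \<Rightarrow> 'a \<Rightarrow> real" where
  "commutator_prob G H g =
     real (card {(x, y). x \<in> H \<and> y \<in> carrier G \<and> group_commutator G x y = g})
       / (real (card H) * real (order G))"

definition commuting_prob :: "('a, 'b) monoid_scheme \<Rightarrow> real" where
  "commuting_prob G =
     real (card {(x, y). x \<in> carrier G \<and> y \<in> carrier G \<and> x \<otimes>\<^bsub>G\<^esub> y = y \<otimes>\<^bsub>G\<^esub> x})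
       / (real (order G))^2"

end

theory Submission
  imports Defs
begin

text \<open>
  Let \<open>P\<close> be the orthogonal projection of the real functions on \<open>G\<close> onto the class functions, and
  \<open>Q\<close> the projection onto the functions that are constant on the cosets of \<open>G'\<close>. The latter are
  class functions, so \<open>D = P - Q\<close> is again an orthogonal projection. Its matrix is
  \[D(a,b) = \frac{|\{y \in G : y a y^{-1} = b\}|}{|G|} - \frac{[a G' = b G']}{|G'|}.\]
  Since \<open>[x,y] = g\<close> means \<open>y x y^{-1} = g^{-1} x\<close>, and \<open>x\<close>, \<open>g^{-1} x\<close> lie in the same coset of
  \<open>G'\<close>, the sum of \<open>D(x, g^{-1} x)\<close> over \<open>x \<in> H\<close> is \<open>|H| (Pr_g(H,G) - 1/|G'|)\<close>. The
  trace of \<open>D\<close> is \<open>|G| (Pr(G) - 1/|G'|)\<close>. A symmetric idempotent matrix satisfies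
  \<open>|D(a,b)| \<le> (D(a,a) + D(b,b)) / 2\<close> (lemma \<open>abs_symmetric_idempotent_le\<close>), so the sum over \<open>H\<close>
  is bounded by half the sum of the diagonal entries over \<open>H\<close> plus half of that over
  \<open>g^{-1} H\<close>, hence by the trace (lemma \<open>sum_symmetric_idempotent_le_trace\<close>). Dividing by \<open>|H|\<close>
  gives the theorem.
\<close>

text \<open>
  The hypothesis \<open>D D\<^sup>T = D\<close> makes \<open>D\<close> symmetric and idempotent at once. The bound is the
  arithmetic-geometric mean inequality applied to each term of the product.
\<close>

lemma abs_symmetric_idempotent_le:
  fixes D :: "'a \<Rightarrow> 'a \<Rightarrow> real"
  assumes idem: "\<And>a b. a \<in> A \<Longrightarrow> b \<in> A \<Longrightarrow> (\<Sum>c\<in>A. D a c * D b c) = D a b"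
    and a: "a \<in> A" and b: "b \<in> A"
  shows "\<bar>D a b\<bar> \<le> (D a a + D b b) / 2"
proof -
  have "\<bar>D a b\<bar> \<le> (\<Sum>c\<in>A. \<bar>D a c * D b c\<bar>)"
    unfolding idem[OF a b, symmetric] by (rule sum_abs)
  also have "\<dots> \<le> (\<Sum>c\<in>A. (D a c * D a c + D b c * D b c) / 2)"
  proof (rule sum_mono)
    fix c
    show "\<bar>D a c * D b c\<bar> \<le> (D a c * D a c + D b c * D b c) / 2"
      using sum_squares_bound[of "\<bar>D a c\<bar>" "\<bar>D b c\<bar>"]
      by (simp add: abs_mult power2_eq_square mult.assoc)
  qed
  also have "\<dots> = (D a a + D b b) / 2"
    using idem[OF a a] idem[OF b b] by (simp add: sum_divide_distrib[symmetric] sum.distrib)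
  finally show ?thesis .
qed

lemma sum_symmetric_idempotent_le_trace:
  fixes D :: "'a \<Rightarrow> 'a \<Rightarrow> real"
  assumes fin: "finite A"
    and idem: "\<And>a b. a \<in> A \<Longrightarrow> b \<in> A \<Longrightarrow> (\<Sum>c\<in>A. D a c * D b c) = D a b"
    and sub: "B \<subseteq> A" and inj: "inj_on f B" and im: "f ` B \<subseteq> A"
  shows "\<bar>\<Sum>x\<in>B. D x (f x)\<bar> \<le> (\<Sum>a\<in>A. D a a)"
proof -
  have nonneg: "0 \<le> D a a" if "a \<in> A" for a
    unfolding idem[OF that that, symmetric] by (rule sum_nonneg) simp
  have "\<bar>\<Sum>x\<in>B. D x (f x)\<bar> \<le> (\<Sum>x\<in>B. \<bar>D x (f x)\<bar>)" by (rule sum_abs)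
  also have "\<dots> \<le> (\<Sum>x\<in>B. (D x x + D (f x) (f x)) / 2)"
  proof (rule sum_mono)
    fix x assume "x \<in> B"
    then have "x \<in> A" "f x \<in> A" using sub im by auto
    then show "\<bar>D x (f x)\<bar> \<le> (D x x + D (f x) (f x)) / 2"
      using abs_symmetric_idempotent_le[of A D x "f x"] idem by blast
  qed
  also have "\<dots> = ((\<Sum>x\<in>B. D x x) + (\<Sum>x\<in>f ` B. D x x)) / 2"
    by (simp add: sum.reindex[OF inj] sum_divide_distrib[symmetric] sum.distrib)
  also have "\<dots> \<le> (\<Sum>a\<in>A. D a a)"
    using sum_mono2[OF fin sub, of "\<lambda>a. D a a"] sum_mono2[OF fin im, of "\<lambda>a. D a a"] nonneg
    by fastforce
  finally show ?thesis .
qed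

text \<open>The number of elements that conjugate \<open>a\<close> to \<open>b\<close>.\<close>

definition conj_count :: "('a, 'b) monoid_scheme \<Rightarrow> 'a \<Rightarrow> 'a \<Rightarrow> nat" where
  "conj_count G a b = card {y \<in> carrier G. y \<otimes>\<^bsub>G\<^esub> a \<otimes>\<^bsub>G\<^esub> inv\<^bsub>G\<^esub> y = b}"

text \<open>
  The matrix of the orthogonal projection onto the class functions whose sum over every right
  coset of \<open>N\<close> is zero, provided that the subgroup \<open>N\<close> contains all commutators: the projection
  onto the class functions minus the projection onto the functions constant on these cosets.
\<close>

definition class_kernel :: "('a, 'b) monoid_scheme \<Rightarrow> 'a set \<Rightarrow> 'a \<Rightarrow> 'a \<Rightarrow> real" where
  "class_kernel G N a b =
     real (conj_count G a b) / real (order G) - of_bool (a \<otimes>\<^bsub>G\<^esub> inv\<^bsub>G\<^esub> b \<in> N) / real (card N)"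

context group
begin

lemma inv_cancel_left:
  assumes "x \<in> carrier G" "y \<in> carrier G"
  shows "inv x \<otimes> (x \<otimes> y) = y" "x \<otimes> (inv x \<otimes> y) = y"
  using assms by (simp_all add: m_assoc[symmetric])

lemma conj_count_sym:
  assumes "a \<in> carrier G" "b \<in> carrier G"
  shows "conj_count G a b = conj_count G b a"
proof -
  have *: "inv y \<otimes> b \<otimes> inv (inv y) = a" 
    if "y \<in> carrier G" "y \<otimes> a \<otimes> inv y = b" "a \<in> carrier G" for a b y
    using that by (auto simp: m_assoc inv_cancel_left)
  show ?thesis unfolding conj_count_def
    by (rule bij_betw_same_card[of "m_inv G"], rule bij_betw_byWitness[where f' = "m_inv G"])
      (use assms * in auto)
qed

lemma conj_count_conj_right:
  assumes "a \<in> carrier G" "b \<in> carrier G" "y \<in> carrier G"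
  shows "conj_count G a (y \<otimes> b \<otimes> inv y) = conj_count G a b"
proof -
  have *: "z \<otimes> a \<otimes> inv z = y \<otimes> b \<otimes> inv y \<longleftrightarrow> (inv y \<otimes> z) \<otimes> a \<otimes> inv (inv y \<otimes> z) = b"
    if "z \<in> carrier G" for z
  proof -
    have "(inv y \<otimes> z) \<otimes> a \<otimes> inv (inv y \<otimes> z) = inv y \<otimes> (z \<otimes> a \<otimes> inv z) \<otimes> y"
      using assms that by (simp add: inv_mult_group m_assoc)
    moreover have "inv y \<otimes> w \<otimes> y = b \<longleftrightarrow> w = y \<otimes> b \<otimes> inv y" if "w \<in> carrier G" for w
      using assms that by (auto simp: m_assoc inv_cancel_left)
    ultimately show ?thesis using assms that by simp
  qed
  have **: "(y \<otimes> z) \<otimes> a \<otimes> inv (y \<otimes> z) = y \<otimes> b \<otimes> inv y \<longleftrightarrow> z \<otimes> a \<otimes> inv z = b"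
    if "z \<in> carrier G" for z
    using *[of "y \<otimes> z"] assms that by (simp add: inv_cancel_left)
  show ?thesis unfolding conj_count_def
    by (rule bij_betw_same_card[of "\<lambda>z. inv y \<otimes> z"],
        rule bij_betw_byWitness[where f' = "\<lambda>z. y \<otimes> z"])
      (use assms in \<open>simp_all add: image_subset_iff inv_cancel_left *[symmetric] **\<close>)
qed

text \<open>Applying the conjugation matrix to \<open>f\<close> amounts to summing \<open>f\<close> over all conjugations of \<open>a\<close>.\<close>

lemma sum_conj_count_mult:
  fixes f :: "'a \<Rightarrow> real"
  assumes fin: "finite (carrier G)" and a: "a \<in> carrier G"
  shows "(\<Sum>c\<in>carrier G. real (conj_count G a c) * f c)
    = (\<Sum>y\<in>carrier G. f (y \<otimes> a \<otimes> inv y))"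
proof -
  have "real (conj_count G a c) * f c
      = (\<Sum>y\<in>carrier G. if c = y \<otimes> a \<otimes> inv y then f c else 0)" for c
    by (simp add: conj_count_def sum.If_cases[OF fin] Int_def eq_commute[of c])
  then have "(\<Sum>c\<in>carrier G. real (conj_count G a c) * f c)
      = (\<Sum>c\<in>carrier G. \<Sum>y\<in>carrier G. if c = y \<otimes> a \<otimes> inv y then f c else 0)"
    by simp
  also have "\<dots> = (\<Sum>y\<in>carrier G. \<Sum>c\<in>carrier G. if c = y \<otimes> a \<otimes> inv y then f c else 0)"
    by (rule sum.swap)
  also have "\<dots> = (\<Sum>y\<in>carrier G. f (y \<otimes> a \<otimes> inv y))"
    using fin a by (intro sum.cong) auto
  finally show ?thesis .
qed

lemma coset_rel_trans_iff:
  assumes "subgroup N G" "a \<in> carrier G" "b \<in> carrier G" "c \<in> carrier G"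
    and bc: "b \<otimes> inv c \<in> N"
  shows "a \<otimes> inv c \<in> N \<longleftrightarrow> a \<otimes> inv b \<in> N"
proof -
  interpret N: subgroup N G by fact
  have 1: "(a \<otimes> inv b) \<otimes> (b \<otimes> inv c) = a \<otimes> inv c"
    using assms(2-4) by (simp add: m_assoc inv_cancel_left)
  have 2: "(a \<otimes> inv c) \<otimes> inv (b \<otimes> inv c) = a \<otimes> inv b"
    using assms(2-4) by (simp add: m_assoc inv_mult_group inv_cancel_left)
  show ?thesis
    using N.m_closed[OF _ bc, of "a \<otimes> inv b"] N.m_closed[OF _ N.m_inv_closed[OF bc], of "a \<otimes> inv c"]
    by (auto simp: 1 2)
qed

lemma card_coset_rel:
  assumes "subgroup N G" "a \<in> carrier G"
  shows "card {c \<in> carrier G. a \<otimes> inv c \<in> N} = card N"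
proof -
  interpret N: subgroup N G by fact
  have 1: "inv (a \<otimes> inv c) \<otimes> a = c" if "c \<in> carrier G" for c
    using assms(2) that by (simp add: inv_mult_group m_assoc)
  have 2: "a \<otimes> inv (inv n \<otimes> a) = n" if "n \<in> carrier G" for n
    using assms(2) that by (simp add: inv_mult_group inv_cancel_left)
  show ?thesis
    by (rule bij_betw_same_card[of "\<lambda>c. a \<otimes> inv c"],
        rule bij_betw_byWitness[where f' = "\<lambda>n. inv n \<otimes> a"])
      (use assms(2) in \<open>auto simp: 1 2\<close>)
qed

text \<open>
  Write \<open>K\<close> for the matrix of conjugation counts and \<open>I\<close> for that of lying in the same coset of
  \<open>N\<close>. Both are symmetric, \<open>K\<^sup>2 = |G| K\<close> and \<open>I\<^sup>2 = |N| I\<close>, and \<open>K I = I K = |G| I\<close>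
  because conjugation moves no element out of its coset when \<open>N\<close> contains the commutators.
\<close>

lemma class_kernel_idempotent:
  assumes fin: "finite (carrier G)" and N: "subgroup N G"
    and comm: "\<And>x y. x \<in> carrier G \<Longrightarrow> y \<in> carrier G \<Longrightarrow> x \<otimes> y \<otimes> inv x \<otimes> inv y \<in> N"
    and a: "a \<in> carrier G" and b: "b \<in> carrier G"
  shows "(\<Sum>c\<in>carrier G. class_kernel G N a c * class_kernel G N b c) = class_kernel G N a b"
proof -
  let ?n = "real (order G)" and ?r = "real (card N)"
  let ?K = "\<lambda>a b. real (conj_count G a b)" and ?I = "\<lambda>a b. of_bool (a \<otimes> inv b \<in> N) :: real"
  interpret N: subgroup N G by fact
  have n: "?n > 0" using fin by (simp add: order_gt_0_iff_finite)
  have r: "?r > 0" using finite_subset[OF N.subset fin] N.one_closed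
    by (metis card_gt_0_iff empty_iff of_nat_0_less_iff)
  have sym: "?I x y = ?I y x" if "x \<in> carrier G" "y \<in> carrier G" for x y
    using coset_rel_trans_iff[OF N, of x y x] coset_rel_trans_iff[OF N, of y x y] that by auto
  have conj: "?I x (y \<otimes> z \<otimes> inv y) = ?I x z"
    if "x \<in> carrier G" "y \<in> carrier G" "z \<in> carrier G" for x y z
  proof -
    have "y \<otimes> z \<otimes> inv y \<otimes> inv z \<in> N" using comm that by simp
    then have "z \<otimes> inv (y \<otimes> z \<otimes> inv y) \<in> N"
      using sym[of z "y \<otimes> z \<otimes> inv y"] that by (simp split: if_splits)
    from coset_rel_trans_iff[OF N _ _ _ this] show ?thesis using that by simp
  qed
  have KK: "(\<Sum>c\<in>carrier G. ?K a c * ?K b c) = ?n * ?K a b"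
    using a b conj_count_sym[OF a b]
    by (simp add: sum_conj_count_mult[OF fin a] conj_count_conj_right order_def)
  have KI: "(\<Sum>c\<in>carrier G. ?K x c * ?I y c) = ?n * ?I y x"
    if "x \<in> carrier G" "y \<in> carrier G" for x y
    using that by (simp add: sum_conj_count_mult[OF fin] conj order_def)
  have II: "(\<Sum>c\<in>carrier G. ?I a c * ?I b c) = ?r * ?I a b"
  proof -
    have "(\<Sum>c\<in>carrier G. ?I a c * ?I b c) = (\<Sum>c\<in>carrier G. ?I a b * ?I b c)"
    proof (rule sum.cong)
      fix c assume "c \<in> carrier G"
      then show "?I a c * ?I b c = ?I a b * ?I b c"
        using coset_rel_trans_iff[OF N a b, of c] by (cases "b \<otimes> inv c \<in> N") simp_all
    qed simp
    also have "\<dots> = ?I a b * (\<Sum>c\<in>carrier G. ?I b c)"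
      by (simp only: sum_distrib_left)
    also have "(\<Sum>c\<in>carrier G. ?I b c) = ?r"
      using fin card_coset_rel[OF N b] by (simp add: of_bool_def sum.If_cases Int_def)
    finally show ?thesis by (simp only: mult.commute)
  qed
  have "class_kernel G N a c * class_kernel G N b c
      = ?K a c * ?K b c / (?n * ?n) - ?K a c * ?I b c / (?n * ?r)
        - ?K b c * ?I a c / (?n * ?r) + ?I a c * ?I b c / (?r * ?r)" for c
    by (simp add: class_kernel_def algebra_simps del: of_bool_eq_0_iff)
  then have "(\<Sum>c\<in>carrier G. class_kernel G N a c * class_kernel G N b c)
      = (\<Sum>c\<in>carrier G. ?K a c * ?K b c) / (?n * ?n) - (\<Sum>c\<in>carrier G. ?K a c * ?I b c) / (?n * ?r)
        - (\<Sum>c\<in>carrier G. ?K b c * ?I a c) / (?n * ?r) + (\<Sum>c\<in>carrier G. ?I a c * ?I b c) / (?r * ?r)"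
    by (simp only: sum.distrib sum_subtractf sum_divide_distrib)
  also have "\<dots> = class_kernel G N a b"
    using n r sym[OF a b] by (simp only: KK KI II a b) (simp add: class_kernel_def field_simps)
  finally show ?thesis .
qed

lemma group_commutator_eq_iff_conj:
  assumes "x \<in> carrier G" "y \<in> carrier G" "g \<in> carrier G"
  shows "group_commutator G x y = g \<longleftrightarrow> y \<otimes> x \<otimes> inv y = inv g \<otimes> x"
proof -
  have "group_commutator G x y = x \<otimes> inv (y \<otimes> x \<otimes> inv y)"
    using assms by (simp add: group_commutator_def inv_mult_group m_assoc)
  moreover have "x \<otimes> inv w = g \<longleftrightarrow> w = inv g \<otimes> x" if "w \<in> carrier G" for w
    using assms that by (auto simp: inv_mult_group m_assoc inv_cancel_left)
  ultimately show ?thesis using assms by simp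
qed

lemma card_commutator_fibre:
  assumes fin: "finite (carrier G)" and H: "H \<subseteq> carrier G" and g: "g \<in> carrier G"
  shows "card {(x, y). x \<in> H \<and> y \<in> carrier G \<and> group_commutator G x y = g}
    = (\<Sum>x\<in>H. conj_count G x (inv g \<otimes> x))"
proof -
  have "{(x, y). x \<in> H \<and> y \<in> carrier G \<and> group_commutator G x y = g}
      = (SIGMA x:H. {y \<in> carrier G. y \<otimes> x \<otimes> inv y = inv g \<otimes> x})"
    using H g group_commutator_eq_iff_conj by blast
  then show ?thesis
    using fin finite_subset[OF H fin] by (simp add: conj_count_def)
qed

lemma card_commuting_pairs:
  assumes "finite (carrier G)"
  shows "card {(x, y). x \<in> carrier G \<and> y \<in> carrier G \<and> x \<otimes> y = y \<otimes> x}
    = (\<Sum>x\<in>carrier G. conj_count G x x)"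
proof -
  have "x \<otimes> y = y \<otimes> x \<longleftrightarrow> group_commutator G x y = \<one>"
    if "x \<in> carrier G" "y \<in> carrier G" for x y
    using that inv_solve_right[of x "y \<otimes> x" y]
    by (auto simp: group_commutator_eq_iff_conj inv_solve_right')
  then have "{(x, y). x \<in> carrier G \<and> y \<in> carrier G \<and> x \<otimes> y = y \<otimes> x}
      = {(x, y). x \<in> carrier G \<and> y \<in> carrier G \<and> group_commutator G x y = \<one>}"
    by blast
  then show ?thesis
    using assms by (simp add: card_commutator_fibre)
qed

end

theorem proposition5p3p1:
  fixes G :: "('a, 'b) monoid_scheme" and H :: "'a set" and g :: 'a
  assumes "group G"
    and "finite (carrier G)"
    and "H \<lhd> G"
    and "g \<in> commutator_subgroup G"
  shows "\<bar>commutator_prob G H g - 1 / real (card (commutator_subgroup G))\<bar>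
    \<le> real (subgroup_index G H) * (commuting_prob G - 1 / real (card (commutator_subgroup G)))"
proof -
  interpret group G by fact
  let ?N = "commutator_subgroup G"
  let ?n = "real (order G)" and ?r = "real (card ?N)" and ?h = "real (card H)"
  let ?D = "class_kernel G ?N"
  note fin = \<open>finite (carrier G)\<close>
  have H: "subgroup H G" using assms(3) by (rule normal_imp_subgroup)
  interpret H: subgroup H G by fact
  have N: "subgroup ?N G"
    unfolding commutator_subgroup_def by (rule derived_is_subgroup) simp
  interpret N: subgroup ?N G by fact
  have comm: "x \<otimes>\<^bsub>G\<^esub> y \<otimes>\<^bsub>G\<^esub> inv\<^bsub>G\<^esub> x \<otimes>\<^bsub>G\<^esub> inv\<^bsub>G\<^esub> y \<in> ?N"
    if "x \<in> carrier G" "y \<in> carrier G" for x y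
    unfolding commutator_subgroup_def derived_def using that by (blast intro: generate.incl)
  have g: "g \<in> carrier G" using assms(4) N.subset by blast
  have n: "?n > 0" using fin by (simp add: order_gt_0_iff_finite)
  have h: "?h > 0" using finite_subset[OF H.subset fin] H.one_closed
    by (metis card_gt_0_iff empty_iff of_nat_0_less_iff)
  have index: "real (subgroup_index G H) = ?n / ?h"
    using lagrange[OF H] h unfolding subgroup_index_def
    by (metis nonzero_eq_divide_eq of_nat_mult order_less_irrefl)
  have "(\<Sum>x\<in>H. ?D x (inv\<^bsub>G\<^esub> g \<otimes>\<^bsub>G\<^esub> x))
      = (\<Sum>x\<in>H. real (conj_count G x (inv\<^bsub>G\<^esub> g \<otimes>\<^bsub>G\<^esub> x)) / ?n - 1 / ?r)"
  proof (rule sum.cong)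
    fix x assume "x \<in> H"
    then have "x \<otimes>\<^bsub>G\<^esub> inv\<^bsub>G\<^esub> (inv\<^bsub>G\<^esub> g \<otimes>\<^bsub>G\<^esub> x) = g"
      using g by (simp add: inv_mult_group inv_cancel_left)
    then show "?D x (inv\<^bsub>G\<^esub> g \<otimes>\<^bsub>G\<^esub> x)
        = real (conj_count G x (inv\<^bsub>G\<^esub> g \<otimes>\<^bsub>G\<^esub> x)) / ?n - 1 / ?r"
      using assms(4) by (simp add: class_kernel_def)
  qed simp
  also have "\<dots> = ?h * (commutator_prob G H g - 1 / ?r)"
    using h n
    by (simp add: commutator_prob_def card_commutator_fibre[OF fin H.subset g] sum_subtractf
        sum_divide_distrib[symmetric] right_diff_distrib)
  finally have off: "(\<Sum>x\<in>H. ?D x (inv\<^bsub>G\<^esub> g \<otimes>\<^bsub>G\<^esub> x)) = ?h * (commutator_prob G H g - 1 / ?r)" .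
  have "(\<Sum>x\<in>carrier G. ?D x x) = (\<Sum>x\<in>carrier G. real (conj_count G x x) / ?n - 1 / ?r)"
    by (intro sum.cong) (simp_all add: class_kernel_def)
  also have "\<dots> = ?n * (commuting_prob G - 1 / ?r)"
    using n
    by (simp add: commuting_prob_def card_commuting_pairs[OF fin] sum_subtractf
        sum_divide_distrib[symmetric] right_diff_distrib power2_eq_square order_def)
  finally have trace: "(\<Sum>x\<in>carrier G. ?D x x) = ?n * (commuting_prob G - 1 / ?r)" .
  have "\<bar>\<Sum>x\<in>H. ?D x (inv\<^bsub>G\<^esub> g \<otimes>\<^bsub>G\<^esub> x)\<bar> \<le> (\<Sum>x\<in>carrier G. ?D x x)"
    by (rule sum_symmetric_idempotent_le_trace[OF fin])
      (use fin N comm g in \<open>auto simp: class_kernel_idempotent inj_on_def\<close>)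
  then have "?h * \<bar>commutator_prob G H g - 1 / ?r\<bar> \<le> ?n * (commuting_prob G - 1 / ?r)"
    unfolding off trace using h by (simp add: abs_mult)
  then show ?thesis
    using h unfolding index by (simp add: field_simps)
qed

end
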